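(* Let $V$ be a real inner-product space of finite dimension $n \ge 1$. Given any orthogonal $T \in GL(V)$, we can write $$T = \mathcal{R}\circ R_{n-2}\circ R_{n-3}\circ\dots\circ R_2\circ R_1,$$ where $R_k$ is a rotational operator on $V$ for each $k\in\{1,2,\ldots,n-2\}$ and $\mathcal{R}$ is either a rotational or a reflectional operator on $V$.
   Context: Throughout, $V$ is a real inner-product space of dimension $n\in\mathbb{N}$, $n\ge1$, and $GL(V)$ is the set of invertible linear operators on $V$. When $n\le 2$ the list $R_1,\dots,R_{n-2}$ is empty and the decomposition reads $T=\mathcal{R}$. Let $W$ be a two-dimensional subspace of $V$ with orthonormal basis $\{u,v\}$. For a fixed real $\theta$, the linear operator on $W$ determined by $u\mapsto(\cos\theta)u+(\sin\theta)v$, $v\mapsto(-\sin\theta)u+(\cos\theta)v$ is called a rotation of $W$; the linear operator on $W$ determined by $u\mapsto u$, $v\mapsto -v$ is called a reflection of $W$. A linear operator on $V$ of the form $\rho\oplus\mathrm{id}$, where $\rho$ is an operator on some two-dimensional subspace $W$ of $V$ and $\mathrm{id}$ is the identity on $W^\perp$, is called a rotational operator (planar rotation) if $\rho$ is a rotation of $W$, and a reflectional operator (planar reflection) if $\rho$ is a reflection of $W$. When $\dim V=1$, the identity operator on $V$ is also called a rotational operator.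
   Formalization: For n = 1 and T = −id the claim fails as written, since a line has no reflectional operator and only the identity is rotational; the formal version allows, only when n = 1, the additional possibility that the last factor is −id. *)

theory Defs
  imports "HOL-Analysis.Analysis"
begin

definition orthonormal_basis2 :: "'a::euclidean_space set \<Rightarrow> 'a \<Rightarrow> 'a \<Rightarrow> bool" where
  "orthonormal_basis2 W u v \<longleftrightarrow>
     norm u = 1 \<and> norm v = 1 \<and> orthogonal u v \<and> span {u, v} = W"

text \<open>Operators on a subspace \<open>W\<close> are total functions of which only the values on \<open>W\<close> matter.
  The condition on all \<open>a *\<^sub>R u + b *\<^sub>R v\<close> says that \<open>\<rho>\<close> is, on \<open>W\<close>, the linear operator
  determined by the prescribed images of \<open>u\<close> and \<open>v\<close>.\<close>

definition rotation_of :: "'a::euclidean_space set \<Rightarrow> ('a \<Rightarrow> 'a) \<Rightarrow> bool" where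
  "rotation_of W \<rho> \<longleftrightarrow>
     (\<exists>u v \<theta>. orthonormal_basis2 W u v \<and>
        (\<forall>a b. \<rho> (a *\<^sub>R u + b *\<^sub>R v) =
                 a *\<^sub>R (cos \<theta> *\<^sub>R u + sin \<theta> *\<^sub>R v)
               + b *\<^sub>R (- sin \<theta> *\<^sub>R u + cos \<theta> *\<^sub>R v)))"

definition reflection_of :: "'a::euclidean_space set \<Rightarrow> ('a \<Rightarrow> 'a) \<Rightarrow> bool" where
  "reflection_of W \<rho> \<longleftrightarrow>
     (\<exists>u v. orthonormal_basis2 W u v \<and>
        (\<forall>a b. \<rho> (a *\<^sub>R u + b *\<^sub>R v) = a *\<^sub>R u + b *\<^sub>R (- v)))"

text \<open>\<open>is_sum_with_id W \<rho> R\<close>: \<open>R\<close> is the direct sum of \<open>\<rho>\<close> on \<open>W\<close> and the identity on the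
  orthogonal complement of \<open>W\<close>.\<close>

definition is_sum_with_id :: "'a::euclidean_space set \<Rightarrow> ('a \<Rightarrow> 'a) \<Rightarrow> ('a \<Rightarrow> 'a) \<Rightarrow> bool" where
  "is_sum_with_id W \<rho> R \<longleftrightarrow> (\<forall>w\<in>W. \<forall>z\<in>orthogonal_comp W. R (w + z) = \<rho> w + z)"

definition rotational :: "('a::euclidean_space \<Rightarrow> 'a) \<Rightarrow> bool" where
  "rotational R \<longleftrightarrow>
     (\<exists>W \<rho>. subspace W \<and> dim W = 2 \<and> rotation_of W \<rho> \<and> is_sum_with_id W \<rho> R) \<or>
     (DIM('a) = 1 \<and> R = id)"

text \<open>In dimension one no operator is reflectional and only the identity is rotational, so the
  orthogonal operator \<open>v \<mapsto> - v\<close> is neither. A decomposition theorem covering all dimensions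
  has to admit it separately.\<close>

definition reflectional :: "('a::euclidean_space \<Rightarrow> 'a) \<Rightarrow> bool" where
  "reflectional R \<longleftrightarrow>
     (\<exists>W \<rho>. subspace W \<and> dim W = 2 \<and> reflection_of W \<rho> \<and> is_sum_with_id W \<rho> R)"

text \<open>\<open>comp_seq R m = R m \<circ> \<dots> \<circ> R 2 \<circ> R 1\<close>; the index 0 is not used.\<close>

primrec comp_seq :: "(nat \<Rightarrow> 'a \<Rightarrow> 'a) \<Rightarrow> nat \<Rightarrow> 'a \<Rightarrow> 'a" where
  "comp_seq R 0 = id"
| "comp_seq R (Suc m) = R (Suc m) \<circ> comp_seq R m"

end

theory Submission
  imports Defs
begin

text \<open>Let \<open>T\<close> fix a set \<open>U\<close> pointwise and take a unit vector \<open>x\<close> orthogonal to \<open>U\<close>. Then \<open>T x\<close> is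
  again a unit vector orthogonal to \<open>U\<close>, so some planar rotation \<open>R\<close> fixes \<open>U\<close> and sends \<open>x\<close> to
  \<open>T x\<close>, and \<open>T \<circ> R\<^sup>-\<^sup>1\<close> fixes \<open>U\<close> and \<open>T x\<close>. Splitting off rotations in this way from
  the right, one is left after \<open>n - 2\<close> steps with an orthogonal operator which fixes all but a plane.\<close>

section \<open>Preliminaries: composition order, orthogonal unit vectors, dimension counts\<close>

text \<open>\<open>comp_seq\<close> unfolds at its last applied factor, whereas the decomposition
  splits off the factor applied first.\<close>

lemma comp_seq_Suc_shift: "comp_seq R (Suc m) = comp_seq (\<lambda>k. R (Suc k)) m \<circ> R 1"
  by (induction m) (simp_all add: fun_eq_iff)

lemma unit_vector_orthogonal_exists:
  fixes U :: "'a::euclidean_space set"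
  assumes "dim U < DIM('a)"
  obtains v where "norm v = 1" "\<And>z. z \<in> U \<Longrightarrow> z \<bullet> v = 0"
proof -
  obtain w where "w \<noteq> 0" and w: "\<And>z. z \<in> span U \<Longrightarrow> orthogonal w z"
    using orthogonal_to_subspace_exists [OF assms] by blast
  show thesis
  proof
    show "norm (w /\<^sub>R norm w) = 1"
      using \<open>w \<noteq> 0\<close> by simp
    show "z \<bullet> (w /\<^sub>R norm w) = 0" if "z \<in> U" for z
      using w [OF span_base [OF that]] by (simp add: orthogonal_def inner_commute)
  qed
qed

lemma dim_insert_orthogonal:
  fixes u :: "'a::euclidean_space"
  assumes "norm u = 1" "\<And>z. z \<in> U \<Longrightarrow> z \<bullet> u = 0"
  shows "dim (insert u U) = Suc (dim U)"
proof -
  have "u \<notin> span U"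
  proof
    assume "u \<in> span U"
    then have "orthogonal u u"
      using assms(2) by (metis inner_commute orthogonal_def orthogonal_to_span)
    then show False
      using assms(1) by (simp add: orthogonal_def)
  qed
  then show ?thesis
    by (simp add: dim_insert)
qed

lemma dim_span_orthonormal_pair:
  fixes u v :: "'a::euclidean_space"
  assumes "norm u = 1" "norm v = 1" "u \<bullet> v = 0"
  shows "dim (span {u, v}) = 2"
proof -
  have "dim {v} = Suc (dim ({} :: 'a set))"
    using assms by (intro dim_insert_orthogonal) auto
  moreover have "dim {u, v} = Suc (dim {v})"
    using assms by (intro dim_insert_orthogonal) (auto simp: inner_commute)
  ultimately show ?thesis
    by simp
qed

section \<open>Recognising planar rotations and reflections\<close>

text \<open>Only the values on the plane matter for the operator on it, so \<open>f\<close> can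
  serve as its own restriction.\<close>

lemma is_sum_with_id_self:
  fixes f :: "'a::euclidean_space \<Rightarrow> 'a"
  assumes "linear f" "\<And>z. u \<bullet> z = 0 \<Longrightarrow> v \<bullet> z = 0 \<Longrightarrow> f z = z"
  shows "is_sum_with_id (span {u, v}) f f"
  using assms
  by (auto simp: is_sum_with_id_def linear_add orthogonal_comp_def orthogonal_def span_base)

lemma rotationalI:
  fixes f :: "'a::euclidean_space \<Rightarrow> 'a"
  assumes uv: "norm u = 1" "norm v = 1" "u \<bullet> v = 0" and f: "linear f"
    and fu: "f u = cos \<theta> *\<^sub>R u + sin \<theta> *\<^sub>R v"
    and fv: "f v = - sin \<theta> *\<^sub>R u + cos \<theta> *\<^sub>R v"
    and fixed: "\<And>z. u \<bullet> z = 0 \<Longrightarrow> v \<bullet> z = 0 \<Longrightarrow> f z = z"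
  shows "rotational f"
proof -
  have "rotation_of (span {u, v}) f"
    unfolding rotation_of_def orthonormal_basis2_def
    using uv fu fv by (intro exI [of _ u] exI [of _ v] exI [of _ \<theta>])
      (simp add: linear_add [OF f] linear_scale [OF f] orthogonal_def)
  then show ?thesis
    unfolding rotational_def
    using dim_span_orthonormal_pair [OF uv] is_sum_with_id_self [OF f fixed] subspace_span
    by blast
qed

lemma reflectionalI:
  fixes f :: "'a::euclidean_space \<Rightarrow> 'a"
  assumes uv: "norm u = 1" "norm v = 1" "u \<bullet> v = 0" and f: "linear f"
    and fu: "f u = u" and fv: "f v = - v"
    and fixed: "\<And>z. u \<bullet> z = 0 \<Longrightarrow> v \<bullet> z = 0 \<Longrightarrow> f z = z"
  shows "reflectional f"
proof -
  have "reflection_of (span {u, v}) f"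
    unfolding reflection_of_def orthonormal_basis2_def
    using uv fu fv by (intro exI [of _ u] exI [of _ v])
      (simp add: linear_add [OF f] linear_scale [OF f] orthogonal_def)
  then show ?thesis
    unfolding reflectional_def
    using dim_span_orthonormal_pair [OF uv] is_sum_with_id_self [OF f fixed] subspace_span
    by blast
qed

section \<open>Explicit planar rotations\<close>

text \<open>For orthonormal \<open>u\<close>, \<open>v\<close>, the coordinates of \<open>x\<close>
  along them are turned by the angle \<open>\<theta>\<close>. Writing this as \<open>x\<close> plus
  the change of the two coordinates avoids projections and makes the fixed vectors evident.\<close>

definition plane_rotation :: "'a::euclidean_space \<Rightarrow> 'a \<Rightarrow> real \<Rightarrow> 'a \<Rightarrow> 'a" where
  "plane_rotation u v \<theta> x =
     x + ((cos \<theta> - 1) * (u \<bullet> x) - sin \<theta> * (v \<bullet> x)) *\<^sub>R u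
       + (sin \<theta> * (u \<bullet> x) + (cos \<theta> - 1) * (v \<bullet> x)) *\<^sub>R v"

lemma linear_plane_rotation: "linear (plane_rotation u v \<theta>)"
  by (rule linearI) (simp_all add: plane_rotation_def algebra_simps)

lemma plane_rotation_fixed: "u \<bullet> z = 0 \<Longrightarrow> v \<bullet> z = 0 \<Longrightarrow> plane_rotation u v \<theta> z = z"
  by (simp add: plane_rotation_def)

context
  fixes u v :: "'a::euclidean_space"
  assumes uv: "norm u = 1" "norm v = 1" "u \<bullet> v = 0"
begin

lemma orthonormal_pair_inner: "u \<bullet> u = 1" "v \<bullet> v = 1" "v \<bullet> u = 0"
  using uv by (simp_all add: norm_eq_1 inner_commute)

lemma plane_rotation_fst: "plane_rotation u v \<theta> u = cos \<theta> *\<^sub>R u + sin \<theta> *\<^sub>R v"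
  by (simp add: plane_rotation_def orthonormal_pair_inner uv algebra_simps)

lemma plane_rotation_snd: "plane_rotation u v \<theta> v = - sin \<theta> *\<^sub>R u + cos \<theta> *\<^sub>R v"
  by (simp add: plane_rotation_def orthonormal_pair_inner uv algebra_simps)

lemma rotational_plane_rotation: "rotational (plane_rotation u v \<theta>)"
  using uv linear_plane_rotation plane_rotation_fst plane_rotation_snd
  by (rule rotationalI) (rule plane_rotation_fixed)

lemma orthogonal_transformation_plane_rotation:
  "orthogonal_transformation (plane_rotation u v \<theta>)"
proof -
  have "plane_rotation u v \<theta> x \<bullet> plane_rotation u v \<theta> y = x \<bullet> y" for x y
  proof -
    define p q p' q' where "p = u \<bullet> x" and "q = v \<bullet> x" and "p' = u \<bullet> y" and "q' = v \<bullet> y"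
    define c s where "c = cos \<theta>" and "s = sin \<theta>"
    have cs: "c * c + s * s = 1"
      using sin_cos_squared_add2 [of \<theta>] by (simp add: c_def s_def power2_eq_square add.commute)
    have "plane_rotation u v \<theta> x \<bullet> plane_rotation u v \<theta> y = x \<bullet> y
        + ((c - 1) * p' - s * q') * p + (s * p' + (c - 1) * q') * q
        + ((c - 1) * p - s * q) * p' + (s * p + (c - 1) * q) * q'
        + ((c - 1) * p - s * q) * ((c - 1) * p' - s * q')
        + (s * p + (c - 1) * q) * (s * p' + (c - 1) * q')"
      unfolding plane_rotation_def p_def [symmetric] q_def [symmetric] p'_def [symmetric]
        q'_def [symmetric] c_def [symmetric] s_def [symmetric]
      by (simp add: inner_add_left inner_add_right orthonormal_pair_inner uv
          inner_commute [of x u] inner_commute [of x v]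
          p_def [symmetric] q_def [symmetric] p'_def [symmetric] q'_def [symmetric] algebra_simps)
    \<comment> \<open>The terms in which \<open>s\<close> occurs to the first power cancel, and 2(c
      - 1) + (c - 1)^2 = c^2 - 1.\<close>
    also have "\<dots> = x \<bullet> y + (c * c + s * s - 1) * (p * p' + q * q')"
      by algebra
    finally show ?thesis
      by (simp add: cs)
  qed
  then show ?thesis
    by (simp add: orthogonal_transformation_def linear_plane_rotation)
qed

end

text \<open>Gram-Schmidt on \<open>x\<close>, \<open>y\<close> gives a plane orthogonal to
  \<open>U\<close>, and the coordinates of \<open>y\<close> in it give the angle. The dimension
  bound leaves room for a plane even if \<open>y\<close> is a multiple of \<open>x\<close>.\<close>

lemma rotation_between_unit_vectors:
  fixes x y :: "'a::euclidean_space"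
  assumes U: "dim U + 2 \<le> DIM('a)"
    and x: "norm x = 1" "\<And>z. z \<in> U \<Longrightarrow> z \<bullet> x = 0"
    and y: "norm y = 1" "\<And>z. z \<in> U \<Longrightarrow> z \<bullet> y = 0"
  obtains R where "rotational R" "orthogonal_transformation R" "R x = y"
    "\<And>z. z \<in> U \<Longrightarrow> R z = z"
proof -
  define c where "c = y - (x \<bullet> y) *\<^sub>R x"
  have xx: "x \<bullet> x = 1"
    using x(1) by (simp add: norm_eq_1)
  have xc: "x \<bullet> c = 0"
    by (simp add: c_def inner_diff_right xx)
  have zc: "z \<bullet> c = 0" if "z \<in> U" for z
    using x(2) y(2) that by (simp add: c_def inner_diff_right)
  \<comment> \<open>If \<open>c = 0\<close>, any unit vector orthogonal to \<open>x\<close> and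
    \<open>U\<close> completes the plane; otherwise \<open>c\<close> is normalised.\<close>
  obtain v where v: "norm v = 1" "x \<bullet> v = 0" "\<And>z. z \<in> U \<Longrightarrow> z \<bullet> v = 0" and cv: "c = norm c *\<^sub>R v"
  proof (cases "c = 0")
    case True
    have "dim (insert x U) < DIM('a)"
      using dim_insert_orthogonal [OF x] U by simp
    then obtain v where "norm v = 1" "\<And>z. z \<in> insert x U \<Longrightarrow> z \<bullet> v = 0"
      by (rule unit_vector_orthogonal_exists) blast
    then show thesis
      using that [of v] True by simp
  next
    case False
    then show thesis
      using that [of "c /\<^sub>R norm c"] xc zc by simp
  qed
  have yeq: "y = (x \<bullet> y) *\<^sub>R x + norm c *\<^sub>R v"
    using cv by (simp add: c_def)
  \<comment> \<open>By Pythagoras the coordinates of \<open>y\<close> lie on the unit circle, which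
    supplies the angle.\<close>
  have "(norm y)\<^sup>2 = (norm ((x \<bullet> y) *\<^sub>R x))\<^sup>2 + (norm c)\<^sup>2"
    using norm_add_Pythagorean [of "(x \<bullet> y) *\<^sub>R x" c] xc by (simp add: orthogonal_def c_def)
  then have "(x \<bullet> y)\<^sup>2 + (norm c)\<^sup>2 = 1"
    using x(1) y(1) by simp
  then obtain \<theta> where "x \<bullet> y = cos \<theta>" "norm c = sin \<theta>"
    by (rule sincos_total_2pi)
  then have "plane_rotation x v \<theta> x = y"
    using yeq plane_rotation_fst [OF x(1) v(1,2)] by simp
  moreover have "plane_rotation x v \<theta> z = z" if "z \<in> U" for z
    using x(2) v(3) that by (intro plane_rotation_fixed) (simp_all add: inner_commute [of _ z])
  ultimately show thesis
    using that rotational_plane_rotation orthogonal_transformation_plane_rotation x(1) v(1,2)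
    by blast
qed

section \<open>Orthogonal operators fixing all but a plane\<close>

text \<open>Adjoining \<open>u\<close> and \<open>v\<close> to \<open>U\<close> fills the whole
  dimension, and inner products with \<open>u\<close> and \<open>v\<close> identify their
  coefficients in \<open>x\<close>.\<close>

lemma orthonormal_complement_decomp:
  fixes U :: "'a::euclidean_space set"
  assumes U: "dim U + 2 = DIM('a)"
    and u: "norm u = 1" "\<And>z. z \<in> U \<Longrightarrow> z \<bullet> u = 0"
    and v: "norm v = 1" "\<And>z. z \<in> insert u U \<Longrightarrow> z \<bullet> v = 0"
  shows "x - (u \<bullet> x) *\<^sub>R u - (v \<bullet> x) *\<^sub>R v \<in> span U"
proof -
  have "dim (insert v (insert u U)) = DIM('a)"
    using dim_insert_orthogonal [OF v, of "insert u U"] dim_insert_orthogonal [OF u, of U] U by simp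
  then have "x \<in> span (insert v (insert u U))"
    by (simp add: dim_eq_full)
  then obtain a b where w: "x - b *\<^sub>R v - a *\<^sub>R u \<in> span U"
    by (auto simp: span_breakdown_eq)
  have "orthogonal u (x - b *\<^sub>R v - a *\<^sub>R u)" "orthogonal v (x - b *\<^sub>R v - a *\<^sub>R u)"
    by (rule orthogonal_to_span [OF w]; use u(2) v(2) in \<open>simp add: orthogonal_def inner_commute\<close>)+
  then have "u \<bullet> x = a" "v \<bullet> x = b"
    using u(1) v by (simp_all add: orthogonal_def inner_diff_right norm_eq_1 inner_commute [of v u])
  then show ?thesis
    using w by (simp add: algebra_simps)
qed

text \<open>The determinant \<open>s\<close> has square 1 by Lagrange's identity, and (c, d) is
  \<open>s\<close> times (a, b) turned by a right angle.\<close>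

lemma orthogonal_matrix2_cases:
  fixes a b c d :: real
  assumes "a\<^sup>2 + b\<^sup>2 = 1" "c\<^sup>2 + d\<^sup>2 = 1" "a * c + b * d = 0"
  shows "c = - b \<and> d = a \<or> c = b \<and> d = - a"
proof -
  define s where "s = a * d - b * c"
  have "s\<^sup>2 = 1"
    using assms unfolding s_def by algebra
  then have "s = 1 \<or> s = -1"
    by (simp add: power2_eq_1_iff)
  moreover have "c = - s * b" "d = s * a"
    using assms unfolding s_def by algebra+
  ultimately show ?thesis
    by auto
qed

text \<open>\<open>T\<close> preserves the plane orthogonal to \<open>U\<close> and acts there by an
  orthogonal 2x2 matrix: determinant 1 gives a rotation, determinant -1 a reflection.\<close>

lemma orthogonal_transformation_fixing_codim2:
  fixes T :: "'a::euclidean_space \<Rightarrow> 'a"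
  assumes T: "orthogonal_transformation T" and U: "dim U + 2 = DIM('a)"
    and fixed: "\<And>z. z \<in> U \<Longrightarrow> T z = z"
  shows "rotational T \<or> reflectional T"
proof -
  have lin: "linear T" and inner: "\<And>x y. T x \<bullet> T y = x \<bullet> y"
    using T by (auto simp: orthogonal_transformation_def)
  obtain u where u: "norm u = 1" "\<And>z. z \<in> U \<Longrightarrow> z \<bullet> u = 0"
    using unit_vector_orthogonal_exists [of U] U by auto
  have "dim (insert u U) < DIM('a)"
    using dim_insert_orthogonal [OF u] U by simp
  then obtain v where v: "norm v = 1" "\<And>z. z \<in> insert u U \<Longrightarrow> z \<bullet> v = 0"
    by (rule unit_vector_orthogonal_exists) blast
  have uv: "u \<bullet> v = 0" "v \<bullet> u = 0" "u \<bullet> u = 1" "v \<bullet> v = 1"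
    using u v by (simp_all add: norm_eq_1 inner_commute [of v u])
  have fixed': "T z = z" if "u \<bullet> z = 0" "v \<bullet> z = 0" for z
  proof -
    have "z \<in> span U"
      using orthonormal_complement_decomp [OF U u v, of z] that by simp
    then show ?thesis
      using linear_eq_on_span [OF lin linear_id] fixed by auto
  qed
  \<comment> \<open>The remainder \<open>w\<close> lies in \<open>span U\<close>, yet is orthogonal
    to \<open>U\<close> because \<open>T\<close> fixes \<open>U\<close> and preserves inner
    products; hence it vanishes.\<close>
  have plane: "T x = (u \<bullet> T x) *\<^sub>R u + (v \<bullet> T x) *\<^sub>R v" if x: "\<And>z. z \<in> U \<Longrightarrow> z \<bullet> x = 0" for x
  proof -
    define w where "w = T x - (u \<bullet> T x) *\<^sub>R u - (v \<bullet> T x) *\<^sub>R v"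
    have "z \<bullet> w = 0" if "z \<in> U" for z
    proof -
      have "z \<bullet> T x = 0"
        using inner [of z x] fixed x that by simp
      then show ?thesis
        using u(2) v(2) that by (simp add: w_def inner_diff_right)
    qed
    moreover have "w \<in> span U"
      unfolding w_def by (rule orthonormal_complement_decomp [OF U u v])
    ultimately have "orthogonal w w"
      by (metis inner_commute orthogonal_def orthogonal_to_span)
    then show ?thesis
      by (simp add: w_def orthogonal_self algebra_simps)
  qed
  define a b c d where "a = u \<bullet> T u" and "b = v \<bullet> T u" and "c = u \<bullet> T v" and "d = v \<bullet> T v"
  have Tu: "T u = a *\<^sub>R u + b *\<^sub>R v"
    using plane [of u] u(2) by (simp add: a_def b_def)
  have Tv: "T v = c *\<^sub>R u + d *\<^sub>R v"
    using plane [of v] v(2) by (simp add: c_def d_def)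
  have ab: "a\<^sup>2 + b\<^sup>2 = 1"
    using inner [of u u] by (simp add: Tu inner_add_left inner_add_right uv power2_eq_square)
  moreover have "c\<^sup>2 + d\<^sup>2 = 1"
    using inner [of v v] by (simp add: Tv inner_add_left inner_add_right uv power2_eq_square)
  moreover have "a * c + b * d = 0"
    using inner [of u v] by (simp add: Tu Tv inner_add_left inner_add_right uv mult.commute)
  ultimately consider "c = - b" "d = a" | "c = b" "d = - a"
    using orthogonal_matrix2_cases by blast
  then show ?thesis
  proof cases
    case 1
    from ab obtain \<theta> where "a = cos \<theta>" "b = sin \<theta>"
      by (rule sincos_total_2pi)
    then have "rotational T"
      using rotationalI [OF u(1) v(1) uv(1) lin, of \<theta>] Tu Tv 1 fixed' by simp
    then show ?thesis ..
  next
    case 2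
    from ab obtain \<theta> where \<theta>: "a = cos \<theta>" "b = sin \<theta>"
      by (rule sincos_total_2pi)
    \<comment> \<open>The mirror line is spanned by the vector at half the angle from \<open>u\<close> to \<open>T u\<close>.\<close>
    define t where "t = \<theta> / 2"
    define e f where "e = cos t *\<^sub>R u + sin t *\<^sub>R v" and "f = - sin t *\<^sub>R u + cos t *\<^sub>R v"
    have ef: "norm e = 1" "norm f = 1" "e \<bullet> f = 0"
      by (simp_all add: e_def f_def norm_eq_1 inner_add_left inner_add_right inner_diff_left
          inner_diff_right uv flip: power2_eq_square)
    \<comment> \<open>These are the difference formulas for 2t - t, with \<open>a\<close> and
      \<open>b\<close> the cosine and sine of 2t.\<close>
    have half: "cos t * a + sin t * b = cos t" "cos t * b - sin t * a = sin t"
      using cos_diff [of "2 * t" t] sin_diff [of "2 * t" t] by (simp_all add: \<theta> t_def algebra_simps)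
    have "T e = (cos t * a + sin t * b) *\<^sub>R u + (cos t * b - sin t * a) *\<^sub>R v"
      by (simp add: e_def linear_add [OF lin] linear_scale [OF lin] Tu Tv 2 algebra_simps)
    then have "T e = e"
      by (simp add: half e_def)
    moreover have "T f = (cos t * b - sin t * a) *\<^sub>R u - (cos t * a + sin t * b) *\<^sub>R v"
      by (simp add: f_def linear_add [OF lin] linear_diff [OF lin] linear_scale [OF lin]
          linear_neg [OF lin] Tu Tv 2 algebra_simps)
    then have "T f = - f"
      by (simp add: half f_def)
    moreover have "T z = z" if "e \<bullet> z = 0" "f \<bullet> z = 0" for z
    proof (rule fixed')
      have e0: "cos t * (u \<bullet> z) + sin t * (v \<bullet> z) = 0"
        and f0: "cos t * (v \<bullet> z) - sin t * (u \<bullet> z) = 0"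
        using that by (simp_all add: e_def f_def inner_add_left inner_diff_left)
      show "u \<bullet> z = 0" "v \<bullet> z = 0"
        \<comment> \<open>Orthogonality to \<open>e\<close> and \<open>f\<close> is a linear system
          in \<open>u \<bullet> z\<close> and \<open>v \<bullet> z\<close> with determinant
          1.\<close>
        using e0 f0 sin_cos_squared_add [of t] by algebra+
    qed
    ultimately have "reflectional T"
      using reflectionalI [OF ef lin] by blast
    then show ?thesis ..
  qed
qed

section \<open>Splitting off rotations by induction\<close>

text \<open>Induction on the number \<open>m\<close> of rotations still to be split off. Each step
  replaces \<open>T\<close> and enlarges \<open>U\<close> by a vector orthogonal to it, so
  \<open>dim U + m\<close> stays constant; both must therefore be arbitrary.\<close>

lemma orthogonal_transformation_decomp:
  fixes T :: "'a::euclidean_space \<Rightarrow> 'a"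
  assumes "orthogonal_transformation T" "dim U + m + 2 = DIM('a)" "\<And>z. z \<in> U \<Longrightarrow> T z = z"
  shows "\<exists>S R. (\<forall>k\<in>{1..m}. rotational (R k)) \<and> (rotational S \<or> reflectional S) \<and>
           T = S \<circ> comp_seq R m"
  using assms
proof (induction m arbitrary: T U)
  case 0
  then have "rotational T \<or> reflectional T"
    by (intro orthogonal_transformation_fixing_codim2 [of T U]) auto
  then show ?case
    by auto
next
  case (Suc m)
  have inner: "\<And>x y. T x \<bullet> T y = x \<bullet> y"
    using Suc.prems(1) by (auto simp: orthogonal_transformation_def)
  obtain x where x: "norm x = 1" "\<And>z. z \<in> U \<Longrightarrow> z \<bullet> x = 0"
    using unit_vector_orthogonal_exists [of U] Suc.prems(2) by auto
  have Tx: "norm (T x) = 1"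
    using x(1) inner [of x x] by (simp add: norm_eq_1)
  have Tx0: "z \<bullet> T x = 0" if "z \<in> U" for z
    using inner [of z x] x(2) Suc.prems(3) that by simp
  obtain Q where Q: "rotational Q" "orthogonal_transformation Q" "Q x = T x"
      "\<And>z. z \<in> U \<Longrightarrow> Q z = z"
    using rotation_between_unit_vectors [of U x "T x"] x Tx Tx0 Suc.prems(2) by auto
  have bijQ: "bij Q"
    using Q(2) by (rule orthogonal_transformation_bij)
  have invQ: "inv Q (Q z) = z" for z
    using bijQ by (simp add: bij_is_inj)
  define T' where "T' = T \<circ> inv Q"
  have "\<exists>S R. (\<forall>k\<in>{1..m}. rotational (R k)) \<and> (rotational S \<or> reflectional S) \<and>
           T' = S \<circ> comp_seq R m"
  proof (rule Suc.IH)
    show "orthogonal_transformation T'"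
      unfolding T'_def using Suc.prems(1) Q(2)
      by (intro orthogonal_transformation_compose orthogonal_transformation_inv)
    show "dim (insert (T x) U) + m + 2 = DIM('a)"
      using dim_insert_orthogonal [OF Tx Tx0] Suc.prems(2) by simp
    show "T' z = z" if "z \<in> insert (T x) U" for z
      using that invQ Q(3,4) Suc.prems(3) by (metis T'_def comp_apply insert_iff)
  qed
  then obtain S R where R: "\<forall>k\<in>{1..m}. rotational (R k)" "rotational S \<or> reflectional S"
      and T': "T' = S \<circ> comp_seq R m"
    by blast
  \<comment> \<open>\<open>Q\<close> is applied first, so it takes index 1 and the other rotations
    move up by one.\<close>
  define R' where "R' k = (if k = 1 then Q else R (k - 1))" for k
  have "comp_seq (\<lambda>k. R' (Suc k)) m = comp_seq R m"
    by (induction m) (simp_all add: R'_def)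
  then have "comp_seq R' (Suc m) = comp_seq R m \<circ> Q"
    unfolding comp_seq_Suc_shift by (simp add: R'_def)
  moreover have "T = T' \<circ> Q"
    by (simp add: T'_def fun_eq_iff invQ)
  ultimately have "T = S \<circ> comp_seq R' (Suc m)"
    by (simp add: T' comp_assoc)
  moreover have "\<forall>k\<in>{1..Suc m}. rotational (R' k)"
  proof
    show "rotational (R' k)" if "k \<in> {1..Suc m}" for k
    proof (cases "k = 1")
      case False
      then have "k - 1 \<in> {1..m}"
        using that by auto
      then show ?thesis
        using R(1) False by (simp add: R'_def)
    qed (simp add: R'_def Q(1))
  qed
  ultimately show ?case
    using R(2) by blast
qed

section \<open>Dimension one and the conclusion\<close>

text \<open>On a line, \<open>T\<close> is determined by the image of a unit vector
  \<open>e\<close>, which is again a unit vector and so equals \<open>e\<close> or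
  \<open>- e\<close>.\<close>

lemma orthogonal_transformation_dim1:
  fixes T :: "'a::euclidean_space \<Rightarrow> 'a"
  assumes T: "orthogonal_transformation T" and dim: "DIM('a) = 1"
  shows "T = id \<or> T = uminus"
proof -
  obtain e :: 'a where e: "Basis = {e}"
    using dim by (rule card_1_singletonE)
  have ee: "e \<bullet> e = 1"
    using e by (metis inner_same_Basis insertI1)
  have rep: "x = (x \<bullet> e) *\<^sub>R e" for x
    using euclidean_representation [of x] by (simp add: e)
  have lin: "linear T" and inner: "T e \<bullet> T e = e \<bullet> e"
    using T by (auto simp: orthogonal_transformation_def)
  have "(T e \<bullet> e)\<^sup>2 = 1"
    using inner by (subst (asm) (1 2) rep [of "T e"]) (simp add: ee power2_eq_square)
  then have "T e = e \<or> T e = - e"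
    using rep [of "T e"] by (auto simp: power2_eq_1_iff)
  moreover have "T x = (x \<bullet> e) *\<^sub>R T e" for x
    by (subst rep) (simp add: linear_scale [OF lin])
  ultimately show ?thesis
    by (metis rep eq_id_iff ext scaleR_minus_right)
qed

theorem theorem5p2:
  fixes T :: "'a::euclidean_space \<Rightarrow> 'a"
  assumes "bij T" and "orthogonal_transformation T"
  shows "\<exists>(\<R> :: 'a \<Rightarrow> 'a) (R :: nat \<Rightarrow> 'a \<Rightarrow> 'a).
           (\<forall>k\<in>{1..DIM('a) - 2}. rotational (R k)) \<and>
           (rotational \<R> \<or> reflectional \<R> \<or> (DIM('a) = 1 \<and> \<R> = uminus)) \<and>
           T = \<R> \<circ> comp_seq R (DIM('a) - 2)"
proof (cases "DIM('a) = 1")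
  case True
  then have "rotational T \<or> (DIM('a) = 1 \<and> T = uminus)"
    using orthogonal_transformation_dim1 [OF assms(2)] by (auto simp: rotational_def)
  \<comment> \<open>Here \<open>DIM('a) - 2\<close> is truncated to 0, so the composition is
    \<open>id\<close> and \<open>T\<close> itself is the remaining factor.\<close>
  then show ?thesis
    using True by auto
next
  case False
  then have "DIM('a) \<ge> 2"
    using DIM_positive [where 'a='a] by linarith
  \<comment> \<open>The induction starts from the empty set, on which the fixing condition is
    vacuous.\<close>
  then have "dim ({} :: 'a set) + (DIM('a) - 2) + 2 = DIM('a)"
    by simp
  from orthogonal_transformation_decomp [OF assms(2) this] show ?thesis
    by blast
qed

end
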